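(* Let $N\ge2$. For every tone $k$, user $n$, reference user $q\in\mathcal N\setminus\{n\}$ and approximation point $\tilde{\mathbf s}_k\in\mathcal S_k$, the per-user approximation $f_k^{\mathrm{IASB3}}$ is tighter than the approximations $f_k^{\mathrm{IASB1}}$ and $f_k^{\mathrm{CADSB}}$ (as functions of $s_k^n\in\mathcal S_k^n$).
   Context: Users $\mathcal N=\{1,\dots,N\}$. On tone $k$, $\mathbf s_k=(s_k^1,\dots,s_k^N)$ are the transmit powers, $\mathcal S_k^n=[0,s_k^{n,\mathrm{mask}}]$ with $s_k^{n,\mathrm{mask}}>0$, $\mathcal S_k=\prod_n\mathcal S_k^n$. Constants: weights $w_n\ge0$, gains $a_k^{n,m}\ge0$, noise powers $z_k^n>0$. Put $\mathrm{int}_k^n=\sum_{m\ne n}a_k^{n,m}s_k^m+z_k^n$, $\mathrm{rec}_k^n=s_k^n+\mathrm{int}_k^n$, and $f_k(\mathbf s_k)=-\sum_{m\in\mathcal N}w_m\log(1+s_k^m/\mathrm{int}_k^m)$. Fix user $n$; all functions below are functions of the single variable $s_k^n\in\mathcal S_k^n$, with $s_k^m=\tilde s_k^m$ for all $m\ne n$. Given a decomposition $f_k=f_k^1+f_k^2$, the associated approximation is $f_k^1+\mathrm{LIN}(f_k^2)$, where $\mathrm{LIN}(f_k^2)$ is the first-order (affine) Taylor approximation of $f_k^2$ at $s_k^n=\tilde s_k^n$. - $f_k^{\mathrm{CADSB}}$: $f_k^1=-\sum_{m\in\mathcal N}w_m\log(\mathrm{rec}_k^m)$, $f_k^2=\sum_{m\in\mathcal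 N}w_m\log(\mathrm{int}_k^m)$. - $f_k^{\mathrm{IASB1}}$: $f_k^1=-w_n\log(1+s_k^n/\mathrm{int}_k^n)$, $f_k^2=-\sum_{m\ne n}w_m\log(1+s_k^m/\mathrm{int}_k^m)$. - $f_k^{\mathrm{IASB3}}$: $f_k^1=-w_n\log(1+s_k^n/\mathrm{int}_k^n)-w_q\log(1+s_k^q/\mathrm{int}_k^q)$, $f_k^2=-\sum_{p\in\mathcal N\setminus\{n,q\}}w_p\log(1+s_k^p/\mathrm{int}_k^p)$. An approximation $A$ is "tighter" than $B$ if its approximation error is no larger along the dimension $s_k^n$: $f_k(s_k^n)\le A(s_k^n)\le B(s_k^n)$ for all $s_k^n\in\mathcal S_k^n$. *)

theory Defs
  imports "HOL-Analysis.Analysis"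
begin

text \<open>
  Users are the naturals in \<open>{1..N}\<close>. The definitions below concern a single tone: \<open>w\<close> are the
  weights, \<open>a n m\<close> the gain from user \<open>m\<close> to user \<open>n\<close> (its diagonal is never used), \<open>z\<close> the noise
  powers and \<open>s\<close> the transmit powers on that tone. Logarithms are natural.
\<close>

definition interference ::
  "nat \<Rightarrow> (nat \<Rightarrow> nat \<Rightarrow> real) \<Rightarrow> (nat \<Rightarrow> real) \<Rightarrow> (nat \<Rightarrow> real) \<Rightarrow> nat \<Rightarrow> real"
  where "interference N a z s n = (\<Sum>m\<in>{1..N} - {n}. a n m * s m) + z n"

definition received ::
  "nat \<Rightarrow> (nat \<Rightarrow> nat \<Rightarrow> real) \<Rightarrow> (nat \<Rightarrow> real) \<Rightarrow> (nat \<Rightarrow> real) \<Rightarrow> nat \<Rightarrow> real"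
  where "received N a z s n = s n + interference N a z s n"

definition user_rate ::
  "nat \<Rightarrow> (nat \<Rightarrow> nat \<Rightarrow> real) \<Rightarrow> (nat \<Rightarrow> real) \<Rightarrow> (nat \<Rightarrow> real) \<Rightarrow> nat \<Rightarrow> real"
  where "user_rate N a z s n = ln (1 + s n / interference N a z s n)"

definition objective ::
  "nat \<Rightarrow> (nat \<Rightarrow> real) \<Rightarrow> (nat \<Rightarrow> nat \<Rightarrow> real) \<Rightarrow> (nat \<Rightarrow> real) \<Rightarrow> (nat \<Rightarrow> real) \<Rightarrow> real"
  where "objective N w a z s = - (\<Sum>m\<in>{1..N}. w m * user_rate N a z s m)"

definition LIN :: "(real \<Rightarrow> real) \<Rightarrow> real \<Rightarrow> real \<Rightarrow> real"
  where "LIN g x0 x = g x0 + deriv g x0 * (x - x0)"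

definition part_linearized :: "(real \<Rightarrow> real) \<Rightarrow> (real \<Rightarrow> real) \<Rightarrow> real \<Rightarrow> real \<Rightarrow> real"
  where "part_linearized f1 f2 x0 x = f1 x + LIN f2 x0 x"

text \<open>
  In the per-user functions, \<open>st\<close> is the approximation point and \<open>x\<close> the power of user \<open>n\<close>, the
  powers of the other users being kept at \<open>st\<close>.
\<close>

definition f_user ::
  "nat \<Rightarrow> (nat \<Rightarrow> real) \<Rightarrow> (nat \<Rightarrow> nat \<Rightarrow> real) \<Rightarrow> (nat \<Rightarrow> real) \<Rightarrow> nat \<Rightarrow> (nat \<Rightarrow> real)
    \<Rightarrow> real \<Rightarrow> real"
  where "f_user N w a z n st x = objective N w a z (st(n := x))"

definition f_CADSB ::
  "nat \<Rightarrow> (nat \<Rightarrow> real) \<Rightarrow> (nat \<Rightarrow> nat \<Rightarrow> real) \<Rightarrow> (nat \<Rightarrow> real) \<Rightarrow> nat \<Rightarrow> (nat \<Rightarrow> real)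
    \<Rightarrow> real \<Rightarrow> real"
  where "f_CADSB N w a z n st =
    part_linearized
      (\<lambda>x. - (\<Sum>m\<in>{1..N}. w m * ln (received N a z (st(n := x)) m)))
      (\<lambda>x. \<Sum>m\<in>{1..N}. w m * ln (interference N a z (st(n := x)) m))
      (st n)"

definition f_IASB1 ::
  "nat \<Rightarrow> (nat \<Rightarrow> real) \<Rightarrow> (nat \<Rightarrow> nat \<Rightarrow> real) \<Rightarrow> (nat \<Rightarrow> real) \<Rightarrow> nat \<Rightarrow> (nat \<Rightarrow> real)
    \<Rightarrow> real \<Rightarrow> real"
  where "f_IASB1 N w a z n st =
    part_linearized
      (\<lambda>x. - w n * user_rate N a z (st(n := x)) n)
      (\<lambda>x. - (\<Sum>m\<in>{1..N} - {n}. w m * user_rate N a z (st(n := x)) m))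
      (st n)"

definition f_IASB3 ::
  "nat \<Rightarrow> (nat \<Rightarrow> real) \<Rightarrow> (nat \<Rightarrow> nat \<Rightarrow> real) \<Rightarrow> (nat \<Rightarrow> real) \<Rightarrow> nat \<Rightarrow> nat \<Rightarrow> (nat \<Rightarrow> real)
    \<Rightarrow> real \<Rightarrow> real"
  where "f_IASB3 N w a z n q st =
    part_linearized
      (\<lambda>x. - w n * user_rate N a z (st(n := x)) n - w q * user_rate N a z (st(n := x)) q)
      (\<lambda>x. - (\<Sum>p\<in>{1..N} - {n, q}. w p * user_rate N a z (st(n := x)) p))
      (st n)"

definition tighter_on ::
  "real set \<Rightarrow> (real \<Rightarrow> real) \<Rightarrow> (real \<Rightarrow> real) \<Rightarrow> (real \<Rightarrow> real) \<Rightarrow> bool"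
  where "tighter_on S f A B \<longleftrightarrow> (\<forall>x\<in>S. f x \<le> A x \<and> A x \<le> B x)"

end

(*
  Write int and rec for the interference and received power of a user. The rate ln rec - ln int is,
  for every user other than n, a convex function of the power of user n, and ln int and ln rec are
  concave. So each linearized term lies above the function it replaces. Comparing user by user,
  IASB3 linearizes fewer users than IASB1; and CADSB exceeds IASB3 by the linearization gap of
  ln int for user q, of ln rec for the users other than n and q, and by nothing for user n, whose
  interference is constant.
*)
theory Submission
  imports Defs
begin

section \<open>Linearization of weighted sums\<close>

lemma LIN_eqI:
  assumes "(g has_real_derivative D) (at x0)"
  shows "LIN g x0 x = g x0 + D * (x - x0)"
  using DERIV_imp_deriv[OF assms] by (simp add: LIN_def)

lemma LIN_const [simp]: "LIN (\<lambda>_. c) x0 x = c"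
  by (simp add: LIN_def)

text \<open>\<open>deriv\<close> distributes over a sum when every summand is differentiable at the
  point. This is what lets the approximations be compared user by user.\<close>

lemma LIN_weighted_sum:
  assumes "\<And>i. i \<in> A \<Longrightarrow> g i field_differentiable at x0"
  shows "LIN (\<lambda>x. \<Sum>i\<in>A. v i * g i x) x0 x = (\<Sum>i\<in>A. v i * LIN (g i) x0 x)"
proof -
  have "((\<lambda>x. \<Sum>i\<in>A. v i * g i x) has_real_derivative (\<Sum>i\<in>A. v i * deriv (g i) x0)) (at x0)"
    by (intro DERIV_sum DERIV_cmult) (use assms field_differentiable_derivI in blast)
  then show ?thesis
    by (simp add: LIN_eqI LIN_def[of "g _"] sum.distrib sum_distrib_right distrib_left mult.assoc)
qed

lemma LIN_neg_weighted_sum: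
  assumes "\<And>i. i \<in> A \<Longrightarrow> g i field_differentiable at x0"
  shows "LIN (\<lambda>x. - (\<Sum>i\<in>A. v i * g i x)) x0 x = - (\<Sum>i\<in>A. v i * LIN (g i) x0 x)"
  using LIN_weighted_sum[of A g x0 "\<lambda>i. - v i"] assms by (simp add: sum_negf)

section \<open>Tangents of logarithms and rates along an affine function\<close>

lemma DERIV_ln_affine:
  fixes \<alpha> \<beta> x0 :: real
  assumes "\<alpha> * x0 + \<beta> > 0"
  shows "((\<lambda>x. ln (\<alpha> * x + \<beta>)) has_real_derivative \<alpha> / (\<alpha> * x0 + \<beta>)) (at x0)"
  using assms by (auto intro!: derivative_eq_intros)

text \<open>Concavity of the logarithm, obtained from \<open>ln t \<le> t - 1\<close> at the ratio
  \<open>t\<close> of the two affine values.\<close>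

lemma ln_affine_le_LIN:
  fixes \<alpha> \<beta> x0 x :: real
  assumes "\<alpha> * x0 + \<beta> > 0" "\<alpha> * x + \<beta> > 0"
  shows "ln (\<alpha> * x + \<beta>) \<le> LIN (\<lambda>x. ln (\<alpha> * x + \<beta>)) x0 x"
proof -
  define u v where "u = \<alpha> * x0 + \<beta>" and "v = \<alpha> * x + \<beta>"
  have "ln v - ln u = ln (v / u)" using assms by (simp add: u_def v_def ln_div)
  also have "\<dots> \<le> v / u - 1" using assms by (intro ln_le_minus_one) (simp add: u_def v_def)
  also have "\<dots> = \<alpha> / u * (x - x0)"
    using assms by (simp add: u_def v_def field_simps)
  finally show ?thesis
    using LIN_eqI[OF DERIV_ln_affine[OF assms(1)]] by (simp add: u_def v_def)
qed

lemma ln_one_plus_divide: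
  fixes s u :: real
  assumes "u > 0" "s \<ge> 0"
  shows "ln (1 + s / u) = ln (s + u) - ln u"
proof -
  have "1 + s / u = (s + u) / u" using assms by (simp add: field_simps)
  then show ?thesis using assms by (simp add: ln_div)
qed

text \<open>The derivative is put in the form of a difference of two logarithmic derivatives, so
  that tangents of rates can be split in the same way as the rates themselves.\<close>

lemma DERIV_rate_affine:
  fixes \<alpha> \<beta> s x0 :: real
  assumes "\<alpha> * x0 + \<beta> > 0" "s \<ge> 0"
  shows "((\<lambda>x. ln (1 + s / (\<alpha> * x + \<beta>))) has_real_derivative
    \<alpha> / (\<alpha> * x0 + (s + \<beta>)) - \<alpha> / (\<alpha> * x0 + \<beta>)) (at x0)"
proof -
  define u where "u = \<alpha> * x0 + \<beta>"
  have u: "u > 0" using assms by (simp add: u_def)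
  have "1 + s / u > 0" using u assms(2) by (simp add: add_pos_nonneg)
  then have "((\<lambda>x. ln (1 + s / (\<alpha> * x + \<beta>))) has_real_derivative
      (- s * \<alpha> / (u * u)) / (1 + s / u)) (at x0)"
    using u by (auto intro!: derivative_eq_intros simp: u_def)
  moreover have "(- s * \<alpha> / (u * u)) / (1 + s / u) = \<alpha> / (u + s) - \<alpha> / u"
  proof -
    have "1 + s / u = (u + s) / u" "u + s \<noteq> 0" using u assms(2) by (auto simp: field_simps)
    then show ?thesis using u by (simp add: divide_simps) (simp add: algebra_simps)
  qed
  ultimately show ?thesis by (simp add: u_def algebra_simps)
qed

lemma LIN_rate_affine:
  fixes \<alpha> \<beta> s x0 x :: real
  assumes "\<alpha> * x0 + \<beta> > 0" "s \<ge> 0"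
  shows "LIN (\<lambda>x. ln (1 + s / (\<alpha> * x + \<beta>))) x0 x
    = LIN (\<lambda>x. ln (\<alpha> * x + (s + \<beta>))) x0 x - LIN (\<lambda>x. ln (\<alpha> * x + \<beta>)) x0 x"
proof -
  have pos: "\<alpha> * x0 + (s + \<beta>) > 0" using assms by simp
  show ?thesis
    unfolding LIN_eqI[OF DERIV_rate_affine[OF assms]] LIN_eqI[OF DERIV_ln_affine[OF pos]]
      LIN_eqI[OF DERIV_ln_affine[OF assms(1)]] ln_one_plus_divide[OF assms] left_diff_distrib
    by (simp add: add.left_commute)
qed

text \<open>Convexity of the rate. The bound \<open>ln t \<le> t - 1\<close> is applied to the ratio
  \<open>t\<close> of the arguments \<open>1 + s / u\<close> and \<open>1 + s / v\<close>; since
  \<open>(s + u) * v - u * (s + v) = s * (v - u)\<close>, only the denominator \<open>v + s\<close>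
  then separates the result from the tangent increment.\<close>

lemma LIN_le_rate_affine:
  fixes \<alpha> \<beta> s x0 x :: real
  assumes pos: "\<alpha> * x0 + \<beta> > 0" "\<alpha> * x + \<beta> > 0" and s: "s \<ge> 0"
  shows "LIN (\<lambda>x. ln (1 + s / (\<alpha> * x + \<beta>))) x0 x \<le> ln (1 + s / (\<alpha> * x + \<beta>))"
proof -
  define u v where "u = \<alpha> * x0 + \<beta>" and "v = \<alpha> * x + \<beta>"
  have u: "u > 0" "u + s > 0" and v: "v > 0" "v + s > 0"
    using pos s by (simp_all add: u_def v_def)
  have "ln (1 + s / u) - ln (1 + s / v) = ln ((s + u) * v / (u * (s + v)))"
    using u v s by (simp add: ln_one_plus_divide ln_mult ln_div)
  also have "\<dots> \<le> (s + u) * v / (u * (s + v)) - 1"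
    using u v s by (intro ln_le_minus_one) simp
  also have "\<dots> = s / u * ((v - u) / (v + s))"
    using u v by (simp add: divide_simps add.commute) (simp add: algebra_simps)
  \<comment> \<open>Replacing \<open>v + s\<close> by \<open>u + s\<close> raises the quotient for
    either sign of \<open>v - u\<close>: a nonnegative numerator gets a smaller denominator, a
    negative one a larger denominator.\<close>
  also have "\<dots> \<le> s / u * ((v - u) / (u + s))"
  proof (rule mult_left_mono)
    show "(v - u) / (v + s) \<le> (v - u) / (u + s)"
    proof (cases "u \<le> v")
      case True
      then show ?thesis using u v by (intro divide_left_mono) auto
    next
      case False
      then show ?thesis using u v by (intro divide_left_mono_neg) auto
    qed
    show "0 \<le> s / u" using u s by simp
  qed
  also have "\<dots> = (1 / u - 1 / (u + s)) * (v - u)"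
    using u by (simp add: divide_simps)
  also have "\<dots> = - ((\<alpha> / (u + s) - \<alpha> / u) * (x - x0))"
    by (simp add: u_def v_def algebra_simps diff_divide_distrib add_divide_distrib)
  finally show ?thesis
    using LIN_eqI[OF DERIV_rate_affine[OF pos(1) s], of x] by (simp add: u_def v_def algebra_simps)
qed

section \<open>Dependence of the interference on the power of one user\<close>

lemma interference_self [simp]:
  "interference N a z (s(n := x)) n = interference N a z s n"
  by (auto simp: interference_def intro!: sum.cong)

text \<open>The interference at power 0 of user \<open>n\<close> serves as the intercept, so slope
  and intercept are both independent of \<open>x\<close>.\<close>

lemma interference_fun_upd:
  assumes "n \<in> {1..N}" "m \<noteq> n"
  shows "interference N a z (s(n := x)) m = a m n * x + interference N a z (s(n := 0)) m"
proof -
  have "(\<Sum>p\<in>{1..N} - {m}. a m p * (s(n := y)) p)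
      = a m n * y + (\<Sum>p\<in>{1..N} - {m} - {n}. a m p * s p)" for y
    using assms by (subst sum.remove[of _ n]) (auto intro!: sum.cong)
  from this[of x] this[of 0] show ?thesis by (simp add: interference_def)
qed

lemma interference_pos:
  assumes "\<And>p. p \<in> {1..N} \<Longrightarrow> a m p \<ge> 0" "\<And>p. p \<in> {1..N} \<Longrightarrow> s p \<ge> 0" "z m > 0"
  shows "interference N a z s m > 0"
  unfolding interference_def using assms by (intro add_nonneg_pos sum_nonneg) auto

lemma user_rate_eq:
  assumes "interference N a z s m > 0" "s m \<ge> 0"
  shows "user_rate N a z s m = ln (received N a z s m) - ln (interference N a z s m)"
  using ln_one_plus_divide[OF assms] by (simp add: user_rate_def received_def)

section \<open>Tangent bounds for the individual users\<close>

context
  fixes N :: nat and w z st :: "nat \<Rightarrow> real" and a :: "nat \<Rightarrow> nat \<Rightarrow> real" and n :: nat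
  assumes w: "\<And>m. m \<in> {1..N} \<Longrightarrow> w m \<ge> 0"
    and a: "\<And>m p. m \<in> {1..N} \<Longrightarrow> p \<in> {1..N} \<Longrightarrow> a m p \<ge> 0"
    and z: "\<And>m. m \<in> {1..N} \<Longrightarrow> z m > 0"
    and st: "\<And>m. m \<in> {1..N} \<Longrightarrow> st m \<ge> 0"
    and n: "n \<in> {1..N}"
begin

lemma interference_fun_upd_pos:
  assumes "m \<in> {1..N}" "x \<ge> 0"
  shows "interference N a z (st(n := x)) m > 0"
  using assms a z st by (intro interference_pos) auto

lemma user_rate_fun_upd:
  assumes "m \<in> {1..N}" "x \<ge> 0"
  shows "user_rate N a z (st(n := x)) m
    = ln (received N a z (st(n := x)) m) - ln (interference N a z (st(n := x)) m)"
  using interference_fun_upd_pos[OF assms] assms st by (intro user_rate_eq) auto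

text \<open>One slope and one intercept serve interference, received power and rate, because
  \<open>st m\<close> stays fixed when user \<open>n\<close> changes power. This carries the
  one-variable lemmas over to the users other than \<open>n\<close>.\<close>

lemma affine_in_user_power:
  assumes m: "m \<in> {1..N}" "m \<noteq> n"
  obtains \<alpha> \<beta> where "\<And>x. x \<ge> 0 \<Longrightarrow> \<alpha> * x + \<beta> > 0"
    "\<And>x. interference N a z (st(n := x)) m = \<alpha> * x + \<beta>"
    "\<And>x. received N a z (st(n := x)) m = \<alpha> * x + (st m + \<beta>)"
    "\<And>x. user_rate N a z (st(n := x)) m = ln (1 + st m / (\<alpha> * x + \<beta>))"
proof
  let ?\<beta> = "interference N a z (st(n := 0)) m"
  show eq: "interference N a z (st(n := x)) m = a m n * x + ?\<beta>" for x
    using n m(2) by (rule interference_fun_upd)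
  show "a m n * x + ?\<beta> > 0" if "x \<ge> 0" for x
    using interference_fun_upd_pos[OF m(1) that] eq[of x] by simp
  show "received N a z (st(n := x)) m = a m n * x + (st m + ?\<beta>)" for x
    using eq[of x] m(2) by (simp add: received_def)
  show "user_rate N a z (st(n := x)) m = ln (1 + st m / (a m n * x + ?\<beta>))" for x
    using eq[of x] m(2) by (simp add: user_rate_def)
qed

lemma LIN_user_rate_le:
  assumes m: "m \<in> {1..N}" "m \<noteq> n" and x: "x \<ge> 0"
  shows "LIN (\<lambda>x. user_rate N a z (st(n := x)) m) (st n) x \<le> user_rate N a z (st(n := x)) m"
  using m
proof (cases rule: affine_in_user_power)
  case (1 \<alpha> \<beta>)
  show ?thesis unfolding 1(4) by (intro LIN_le_rate_affine 1(1) st n m x)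
qed

lemma ln_interference_le_LIN:
  assumes m: "m \<in> {1..N}" "m \<noteq> n" and x: "x \<ge> 0"
  shows "ln (interference N a z (st(n := x)) m)
    \<le> LIN (\<lambda>x. ln (interference N a z (st(n := x)) m)) (st n) x"
  using m
proof (cases rule: affine_in_user_power)
  case (1 \<alpha> \<beta>)
  show ?thesis unfolding 1(2) by (intro ln_affine_le_LIN 1(1) st n x)
qed

text \<open>The right-hand side is the tangent of the concave \<open>ln\<close> of the received
  power, split by \<open>LIN_rate_affine\<close> into the two tangents that occur in CADSB and
  IASB3.\<close>

lemma ln_received_le_LIN:
  assumes m: "m \<in> {1..N}" "m \<noteq> n" and x: "x \<ge> 0"
  shows "ln (received N a z (st(n := x)) m)
    \<le> LIN (\<lambda>x. ln (interference N a z (st(n := x)) m)) (st n) x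
      + LIN (\<lambda>x. user_rate N a z (st(n := x)) m) (st n) x"
  using m
proof (cases rule: affine_in_user_power)
  case (1 \<alpha> \<beta>)
  have pos: "\<alpha> * y + (st m + \<beta>) > 0" if "y \<ge> 0" for y
    using 1(1)[OF that] st[OF m(1)] by simp
  have "ln (received N a z (st(n := x)) m) \<le> LIN (\<lambda>x. ln (\<alpha> * x + (st m + \<beta>))) (st n) x"
    unfolding 1(3) by (intro ln_affine_le_LIN pos st n x)
  then show ?thesis
    unfolding 1(2,4) using LIN_rate_affine[OF 1(1) st] n st m(1) by simp
qed

lemma field_differentiable_ln_interference:
  assumes m: "m \<in> {1..N}"
  shows "(\<lambda>x. ln (interference N a z (st(n := x)) m)) field_differentiable at (st n)"
proof (cases "m = n")
  case True
  then show ?thesis by simp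
next
  case False
  with m show ?thesis
  proof (cases rule: affine_in_user_power)
    case (1 \<alpha> \<beta>)
    show ?thesis unfolding 1(2) field_differentiable_def
      using DERIV_ln_affine[OF 1(1)] st n by blast
  qed
qed

lemma field_differentiable_user_rate:
  assumes m: "m \<in> {1..N}" "m \<noteq> n"
  shows "(\<lambda>x. user_rate N a z (st(n := x)) m) field_differentiable at (st n)"
  using m
proof (cases rule: affine_in_user_power)
  case (1 \<alpha> \<beta>)
  show ?thesis unfolding 1(4) field_differentiable_def
    using DERIV_rate_affine[OF 1(1) st] m(1) st n by blast
qed

text \<open>With each approximation written as a single sum over all users with the same weights, an
  inequality between two of them follows termwise.\<close>

lemma f_IASB3_eq_sum:
  assumes q: "q \<in> {1..N} - {n}"
  shows "f_IASB3 N w a z n q st x = (\<Sum>m\<in>{1..N}. w m *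
    (if m \<in> {n, q} then - user_rate N a z (st(n := x)) m
     else - LIN (\<lambda>x. user_rate N a z (st(n := x)) m) (st n) x))"
proof -
  have "{1..N} = insert n (insert q ({1..N} - {n, q}))" using n q by auto
  then have split: "(\<Sum>m\<in>{1..N}. g m) = g n + (g q + (\<Sum>m\<in>{1..N} - {n, q}. g m))"
    for g :: "nat \<Rightarrow> real"
    \<comment> \<open>Since \<open>q\<close> differs from \<open>n\<close>, each insertion adds a
      new element.\<close>
    using q by (metis (no_types, lifting) DiffE finite_Diff finite_atLeastAtMost finite_insert
        insertE insertI1 insertI2 singletonI sum.insert)
  show ?thesis
    unfolding f_IASB3_def part_linearized_def split
    by (subst LIN_neg_weighted_sum) (auto intro: field_differentiable_user_rate simp: sum_negf)
qed

lemma f_IASB1_eq_sum: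
  "f_IASB1 N w a z n st x = (\<Sum>m\<in>{1..N}. w m *
    (if m = n then - user_rate N a z (st(n := x)) m
     else - LIN (\<lambda>x. user_rate N a z (st(n := x)) m) (st n) x))"
  unfolding f_IASB1_def part_linearized_def sum.remove[OF finite_atLeastAtMost n]
  by (subst LIN_neg_weighted_sum) (auto intro: field_differentiable_user_rate simp: sum_negf)

lemma f_CADSB_eq_sum:
  "f_CADSB N w a z n st x = (\<Sum>m\<in>{1..N}. w m *
    (LIN (\<lambda>x. ln (interference N a z (st(n := x)) m)) (st n) x - ln (received N a z (st(n := x)) m)))"
  unfolding f_CADSB_def part_linearized_def
  by (subst LIN_weighted_sum)
    (auto intro: field_differentiable_ln_interference simp: right_diff_distrib sum_subtractf)

section \<open>Termwise comparison of the approximations\<close>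

lemma f_user_le_f_IASB3:
  assumes "q \<in> {1..N} - {n}" "x \<ge> 0"
  shows "f_user N w a z n st x \<le> f_IASB3 N w a z n q st x"
  unfolding f_user_def objective_def f_IASB3_eq_sum[OF assms(1)] sum_negf[symmetric]
    mult_minus_right[symmetric]
  using assms by (intro sum_mono mult_left_mono w) (auto intro: LIN_user_rate_le)

text \<open>The two sums differ only in the term of user \<open>q\<close>, whose rate IASB1 replaces
  by its tangent.\<close>

lemma f_IASB3_le_f_IASB1:
  assumes "q \<in> {1..N} - {n}" "x \<ge> 0"
  shows "f_IASB3 N w a z n q st x \<le> f_IASB1 N w a z n st x"
  unfolding f_IASB3_eq_sum[OF assms(1)] f_IASB1_eq_sum
  using assms by (intro sum_mono mult_left_mono w) (auto intro: LIN_user_rate_le)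

lemma f_IASB3_le_f_CADSB:
  assumes q: "q \<in> {1..N} - {n}" and x: "x \<ge> 0"
  shows "f_IASB3 N w a z n q st x \<le> f_CADSB N w a z n st x"
  unfolding f_IASB3_eq_sum[OF q] f_CADSB_eq_sum
proof (intro sum_mono mult_left_mono w)
  fix m assume m: "m \<in> {1..N}"
  show "(if m \<in> {n, q} then - user_rate N a z (st(n := x)) m
     else - LIN (\<lambda>x. user_rate N a z (st(n := x)) m) (st n) x)
    \<le> LIN (\<lambda>x. ln (interference N a z (st(n := x)) m)) (st n) x - ln (received N a z (st(n := x)) m)"
  proof (cases "m = n")
    case True
    \<comment> \<open>The interference of user \<open>n\<close> is constant in \<open>x\<close>,
      hence equal to its linearization, and the two terms agree.\<close>
    then show ?thesis using user_rate_fun_upd[OF m x] by simp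
  next
    case False
    \<comment> \<open>For \<open>m = q\<close> the tangent bound on \<open>ln\<close> of the
      interference decides; for the remaining users, the one on \<open>ln\<close> of the received
      power.\<close>
    then show ?thesis
      using user_rate_fun_upd[OF m x] ln_interference_le_LIN[OF m _ x] ln_received_le_LIN[OF m _ x]
      by auto
  qed
qed

end

theorem mainTheorem4:
  fixes N :: nat
    and tones :: "'k set"
    and w :: "nat \<Rightarrow> real"
    and a :: "'k \<Rightarrow> nat \<Rightarrow> nat \<Rightarrow> real"
    and z smask :: "'k \<Rightarrow> nat \<Rightarrow> real"
    and st :: "nat \<Rightarrow> real"
    and k :: 'k
    and n q :: nat
  assumes "N \<ge> 2"
    and "\<And>m. m \<in> {1..N} \<Longrightarrow> w m \<ge> 0"
    and "\<And>j m p. j \<in> tones \<Longrightarrow> m \<in> {1..N} \<Longrightarrow> p \<in> {1..N} \<Longrightarrow> a j m p \<ge> 0"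
    and "\<And>j m. j \<in> tones \<Longrightarrow> m \<in> {1..N} \<Longrightarrow> z j m > 0"
    and "\<And>j m. j \<in> tones \<Longrightarrow> m \<in> {1..N} \<Longrightarrow> smask j m > 0"
    and "k \<in> tones"
    and "n \<in> {1..N}"
    and "q \<in> {1..N} - {n}"
    and "st \<in> (\<Pi> m\<in>{1..N}. {0..smask k m})"
  shows "tighter_on {0..smask k n} (f_user N w (a k) (z k) n st)
           (f_IASB3 N w (a k) (z k) n q st) (f_IASB1 N w (a k) (z k) n st)
       \<and> tighter_on {0..smask k n} (f_user N w (a k) (z k) n st)
           (f_IASB3 N w (a k) (z k) n q st) (f_CADSB N w (a k) (z k) n st)"
proof -
  have "st m \<ge> 0" if "m \<in> {1..N}" for m
    using assms(9) that by (auto simp: Pi_iff)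
  \<comment> \<open>The hypotheses are specialized to tone \<open>k\<close>; membership in the mask
    interval then supplies the condition \<open>x \<ge> 0\<close> of the bounds.\<close>
  note facts = assms(2) assms(3)[OF assms(6)] assms(4)[OF assms(6)] this assms(7,8)
  show ?thesis
    unfolding tighter_on_def
    using f_user_le_f_IASB3[of N w "a k" "z k" st n q] f_IASB3_le_f_IASB1[of N w "a k" "z k" st n q]
      f_IASB3_le_f_CADSB[of N w "a k" "z k" st n q] facts
    by simp
qed

end
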